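(* Define maps $r_1,r_2:\mathbb{R}^3\times\mathbb{R}^3\to\mathbb{R}^3\times\mathbb{R}^3$ by $$r_1\big((x_1,y_1,z_1),(x_2,y_2,z_2)\big)=\big((x_2,y_2,z_2+x_1y_2),\,(x_1,y_1,z_1-x_2y_1)\big),$$ $$r_2\big((x_1,y_1,z_1),(x_2,y_2,z_2)\big)=\big((x_2,y_2,z_2-x_1y_2),\,(x_1,y_1,z_1+x_1y_2)\big).$$ Then both $(\mathbb{R}^3,r_1)$ and $(\mathbb{R}^3,r_2)$ are topological biquandles, where $\mathbb{R}^3$ carries its usual topology.
   Context: A biquandle is a set $X$ with a bijective map $r:X\times X\to X\times X$, written $r(a,b)=(b\star a,\,a\ast b)$ (this defines the two binary operations $\star$ and $\ast$ on $X$), satisfying the following axioms. (1) $r$ satisfies the set-theoretic Yang-Baxter equation $(\mathrm{Id}\times r)\circ(r\times\mathrm{Id})\circ(\mathrm{Id}\times r)=(r\times\mathrm{Id})\circ(\mathrm{Id}\times r)\circ(r\times\mathrm{Id})$ on $X\times X\times X$ (here $\circ$ is composition of maps). (2) For every $a\in X$, the maps $\star a:X\to X$, $x\mapsto x\star a$, and $\ast a:X\to X$, $x\mapsto x\ast a$, are both bijective; these induce a unique bijective map $S:X\times X\to X\times X$ such that $S(b\star a,\,a)=(a\ast b,\,b)$ for all $a,b\in X$. (3) $S$ induces a bijection $\tau:X\to X$ on the diagonal, i.e. $S(a,a)=(\tau(a),\tau(a))$ for all $a\in X$, with $\tau$ bijective. A topological biquandle is a topological space $X$ with a biquandle structure such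 that both operations $\ast,\star:X\times X\to X$ are continuous. *)

theory Defs
  imports "HOL-Analysis.Analysis"
begin

text \<open>The two operations are read off from \<open>r (a, b) = (b \<star> a, a \<ast> b)\<close>; note the argument
  order in the first component.\<close>

definition bq_star :: "('a \<times> 'a \<Rightarrow> 'a \<times> 'a) \<Rightarrow> 'a \<Rightarrow> 'a \<Rightarrow> 'a" where
  "bq_star r b a = fst (r (a, b))"

definition bq_ast :: "('a \<times> 'a \<Rightarrow> 'a \<times> 'a) \<Rightarrow> 'a \<Rightarrow> 'a \<Rightarrow> 'a" where
  "bq_ast r a b = snd (r (a, b))"

definition times_Id :: "('a \<times> 'a \<Rightarrow> 'a \<times> 'a) \<Rightarrow> 'a \<times> 'a \<times> 'a \<Rightarrow> 'a \<times> 'a \<times> 'a" where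
  "times_Id r = (\<lambda>(a, b, c). (fst (r (a, b)), snd (r (a, b)), c))"

definition Id_times :: "('a \<times> 'a \<Rightarrow> 'a \<times> 'a) \<Rightarrow> 'a \<times> 'a \<times> 'a \<Rightarrow> 'a \<times> 'a \<times> 'a" where
  "Id_times r = (\<lambda>(a, b, c). (a, r (b, c)))"

definition yang_baxter_on :: "'a set \<Rightarrow> ('a \<times> 'a \<Rightarrow> 'a \<times> 'a) \<Rightarrow> bool" where
  "yang_baxter_on X r \<longleftrightarrow>
     (\<forall>t \<in> X \<times> X \<times> X. (Id_times r \<circ> times_Id r \<circ> Id_times r) t =
                      (times_Id r \<circ> Id_times r \<circ> times_Id r) t)"

definition bq_sideways :: "'a set \<Rightarrow> ('a \<times> 'a \<Rightarrow> 'a \<times> 'a) \<Rightarrow> ('a \<times> 'a \<Rightarrow> 'a \<times> 'a) \<Rightarrow> bool" where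
  "bq_sideways X r S \<longleftrightarrow>
     bij_betw S (X \<times> X) (X \<times> X) \<and>
     (\<forall>a\<in>X. \<forall>b\<in>X. S (bq_star r b a, a) = (bq_ast r a b, b))"

text \<open>The last assumption quantifies \<open>S\<close> existentially; by \<open>bq_sideways_ex1\<close> below, the other
  assumptions already determine \<open>S\<close> on \<open>X \<times> X\<close>.\<close>

locale biquandle =
  fixes X :: "'a set" and r :: "'a \<times> 'a \<Rightarrow> 'a \<times> 'a"
  assumes bij_r: "bij_betw r (X \<times> X) (X \<times> X)"
    and yang_baxter: "yang_baxter_on X r"
    and bij_star: "a \<in> X \<Longrightarrow> bij_betw (\<lambda>x. bq_star r x a) X X"
    and bij_ast: "a \<in> X \<Longrightarrow> bij_betw (\<lambda>x. bq_ast r x a) X X"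
    and diagonal: "\<exists>S \<tau>. bq_sideways X r S \<and> bij_betw \<tau> X X \<and> (\<forall>a\<in>X. S (a, a) = (\<tau> a, \<tau> a))"

lemma bq_sideways_ex1:
  assumes star: "\<And>a. a \<in> X \<Longrightarrow> bij_betw (\<lambda>x. bq_star r x a) X X"
    and ast: "\<And>a. a \<in> X \<Longrightarrow> bij_betw (\<lambda>x. bq_ast r x a) X X"
  shows "\<exists>!S. S \<in> extensional (X \<times> X) \<and> bq_sideways X r S"
proof -
  define F where "F = (\<lambda>(b, a). (bq_star r b a, a))"
  define G where "G = (\<lambda>(b, a). (bq_ast r a b, b))"
  have F: "bij_betw F (X \<times> X) (X \<times> X)"
    using star by (fastforce simp: F_def bij_betw_def inj_on_def image_iff set_eq_iff)
  have G: "bij_betw G (X \<times> X) (X \<times> X)"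
    using ast by (fastforce simp: G_def bij_betw_def inj_on_def image_iff set_eq_iff)
  define S where "S = restrict (G \<circ> inv_into (X \<times> X) F) (X \<times> X)"
  have "bij_betw (G \<circ> inv_into (X \<times> X) F) (X \<times> X) (X \<times> X)"
    by (rule bij_betw_trans[OF bij_betw_inv_into[OF F] G])
  then have bS: "bij_betw S (X \<times> X) (X \<times> X)"
    unfolding S_def by (subst bij_betw_restrict_eq)
  have eq: "S (F p) = G p" if "p \<in> X \<times> X" for p
  proof -
    have "F p \<in> X \<times> X"
      using that bij_betw_apply[OF F] by blast
    then show ?thesis
      using that F by (simp add: S_def bij_betw_inv_into_left)
  qed
  have eq': "S (bq_star r b a, a) = (bq_ast r a b, b)" if "a \<in> X" "b \<in> X" for a b
    using eq[of "(b, a)"] that by (simp add: F_def G_def)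
  show ?thesis
  proof (rule ex1I[of _ S])
    show "S \<in> extensional (X \<times> X) \<and> bq_sideways X r S"
      using bS eq' by (auto simp: bq_sideways_def S_def)
  next
    fix S' assume S': "S' \<in> extensional (X \<times> X) \<and> bq_sideways X r S'"
    show "S' = S"
    proof (rule extensionalityI[of _ "X \<times> X"])
      fix q assume "q \<in> X \<times> X"
      then obtain p where p: "p \<in> X \<times> X" "q = F p"
        using F unfolding bij_betw_def by blast
      then show "S' q = S q"
        using S' eq[of p] by (auto simp: bq_sideways_def F_def G_def)
    qed (use S' in \<open>auto simp: S_def\<close>)
  qed
qed

locale topological_biquandle = biquandle "topspace T" r
  for T :: "'a topology" and r :: "'a \<times> 'a \<Rightarrow> 'a \<times> 'a" +
  assumes continuous_ast: "continuous_map (prod_topology T T) T (\<lambda>(a, b). bq_ast r a b)"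
    and continuous_star: "continuous_map (prod_topology T T) T (\<lambda>(a, b). bq_star r a b)"

text \<open>With \<open>p = (x\<^sub>1, y\<^sub>1, z\<^sub>1)\<close> and \<open>q = (x\<^sub>2, y\<^sub>2, z\<^sub>2)\<close>.\<close>

definition r1 :: "(real^3) \<times> (real^3) \<Rightarrow> (real^3) \<times> (real^3)" where
  "r1 = (\<lambda>(p, q). (vector [q$1, q$2, q$3 + p$1 * q$2], vector [p$1, p$2, p$3 - q$1 * p$2]))"

definition r2 :: "(real^3) \<times> (real^3) \<Rightarrow> (real^3) \<times> (real^3)" where
  "r2 = (\<lambda>(p, q). (vector [q$1, q$2, q$3 - p$1 * q$2], vector [p$1, p$2, p$3 + p$1 * q$2]))"

end

theory Submission
  imports Defs
begin

text \<open>
  Both maps are twisted flips: \<open>(a, b)\<close> goes to \<open>(b, a)\<close>, after which the two entries are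
  translated along the third axis by amounts \<open>f a b\<close> and \<open>g a b\<close> that depend only on the first
  two coordinates of \<open>a\<close> and \<open>b\<close>. Since a translation along the third axis does not change these
  coordinates, later translations do not notice earlier ones. Hence each map in the biquandle
  axioms is inverted by subtracting what was added, and each side of the Yang-Baxter equation
  sends \<open>(a, b, c)\<close> to
  \<open>(c + f a c + f b c, b + f a b + g b c, a + g a b + g a c)\<close>: every pair of entries is crossed
  exactly once, and the order of the crossings is irrelevant.

  The diagonal axiom is the only one that relates \<open>f\<close> to \<open>g\<close>. The sideways map sends \<open>(u, a)\<close> to
  \<open>(a + g a u, u - f a u)\<close>, so it preserves the diagonal exactly when \<open>g a a = - f a a\<close>. This
  holds for both maps, with \<open>f a a\<close> equal to \<open>x y\<close> and \<open>- x y\<close> at \<open>a = (x, y, z)\<close>.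

  The argument works in any topological abelian group and is carried out there.
\<close>

text \<open>The set \<open>K\<close> makes "depends only on the first two coordinates" independent of coordinates: it
  contains all the translations that occur, and \<open>f\<close> and \<open>g\<close> do not change under them. For \<open>\<real>\<^sup>3\<close>
  it is the third axis.\<close>

locale twisted_flip =
  fixes K :: "'a :: topological_ab_group_add set" and f g :: "'a \<Rightarrow> 'a \<Rightarrow> 'a"
  assumes f_in: "f a b \<in> K" and g_in: "g a b \<in> K"
    and f_left: "k \<in> K \<Longrightarrow> f (a + k) b = f a b"
    and f_right: "k \<in> K \<Longrightarrow> f a (b + k) = f a b"
    and g_left: "k \<in> K \<Longrightarrow> g (a + k) b = g a b"
    and g_right: "k \<in> K \<Longrightarrow> g a (b + k) = g a b"
    and g_diagonal: "g a a = - f a a"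
    and continuous_f: "continuous_on UNIV (\<lambda>(a, b). f a b)"
    and continuous_g: "continuous_on UNIV (\<lambda>(a, b). g a b)"
begin

definition flip :: "'a \<times> 'a \<Rightarrow> 'a \<times> 'a" where
  "flip = (\<lambda>(a, b). (b + f a b, a + g a b))"

text \<open>Adding \<open>k\<close> to \<open>a - k\<close> gives \<open>a\<close>, so invariance under addition yields invariance under
  subtraction. The inverse maps below subtract values of \<open>f\<close> and \<open>g\<close>, which is where this is
  used.\<close>

lemma minus_invariant:
  assumes "k \<in> K"
  shows "f (a - k) b = f a b" "f a (b - k) = f a b" "g (a - k) b = g a b" "g a (b - k) = g a b"
  using f_left[OF assms, of "a - k" b] f_right[OF assms, of a "b - k"]
    g_left[OF assms, of "a - k" b] g_right[OF assms, of a "b - k"] by simp_all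

lemmas invariant = f_in g_in f_left f_right g_left g_right minus_invariant

lemma bq_star_flip: "bq_star flip b a = b + f a b"
  by (simp add: bq_star_def flip_def)

lemma bq_ast_flip: "bq_ast flip a b = a + g a b"
  by (simp add: bq_ast_def flip_def)

lemma bij_flip: "bij flip"
  by (rule o_bij[where g = "\<lambda>(u, v). (v - g v u, u - f v u)"])
    (auto simp: fun_eq_iff flip_def invariant)

lemma yang_baxter_flip: "yang_baxter_on UNIV flip"
  by (auto simp: yang_baxter_on_def Id_times_def times_Id_def flip_def invariant algebra_simps)

lemma bij_star_flip: "bij (\<lambda>x. bq_star flip x a)"
  by (rule o_bij[where g = "\<lambda>u. u - f a u"]) (auto simp: fun_eq_iff bq_star_flip invariant)

lemma bij_ast_flip: "bij (\<lambda>x. bq_ast flip x a)"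
  by (rule o_bij[where g = "\<lambda>u. u - g u a"]) (auto simp: fun_eq_iff bq_ast_flip invariant)

text \<open>Put \<open>u = b + f a b\<close>. Then \<open>f a u = f a b\<close> and \<open>g a u = g a b\<close>, so \<open>b\<close> and \<open>a + g a b\<close> can
  both be recovered from \<open>u\<close> and \<open>a\<close>.\<close>

lemma sideways_flip: "bq_sideways UNIV flip (\<lambda>(u, a). (a + g a u, u - f a u))"
proof -
  have "bij (\<lambda>(u, a). (a + g a u, u - f a u))"
    by (rule o_bij[where g = "\<lambda>(v, b). (b + f v b, v - g v b)"])
      (auto simp: fun_eq_iff invariant)
  then show ?thesis
    by (simp add: bq_sideways_def bq_star_flip bq_ast_flip invariant)
qed

lemma bij_diagonal: "bij (\<lambda>a. a + g a a)"
  by (rule o_bij[where g = "\<lambda>a. a - g a a"]) (auto simp: fun_eq_iff invariant)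

lemma continuous_ast_flip: "continuous_on UNIV (\<lambda>(a, b). bq_ast flip a b)"
  using continuous_g by (auto simp: bq_ast_flip case_prod_beta intro!: continuous_intros)

lemma continuous_star_flip: "continuous_on UNIV (\<lambda>(a, b). bq_star flip a b)"
proof -
  have "continuous_on UNIV ((\<lambda>(a, b). f a b) \<circ> prod.swap)"
    by (rule continuous_on_compose)
      (auto intro: continuous_on_swap continuous_on_subset[OF continuous_f])
  then show ?thesis
    by (auto simp: bq_star_flip case_prod_beta intro!: continuous_intros)
qed

theorem topological_biquandle_flip: "topological_biquandle euclidean flip"
proof
  show "\<exists>S \<tau>. bq_sideways (topspace euclidean) flip S \<and>
      bij_betw \<tau> (topspace euclidean) (topspace euclidean) \<and>
      (\<forall>a\<in>topspace euclidean. S (a, a) = (\<tau> a, \<tau> a))"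
    by (rule exI[of _ "\<lambda>(u, a). (a + g a u, u - f a u)"], rule exI[of _ "\<lambda>a. a + g a a"])
      (use bij_diagonal in \<open>simp add: sideways_flip g_diagonal\<close>)
qed (use bij_flip yang_baxter_flip bij_star_flip bij_ast_flip
       continuous_ast_flip continuous_star_flip in
     \<open>simp_all add: euclidean_product_topology\<close>)

end

theorem corollary3p2:
  "topological_biquandle euclidean r1 \<and> topological_biquandle euclidean r2"
proof
  interpret F1: twisted_flip "range (\<lambda>t. t *\<^sub>R axis 3 1) :: (real^3) set"
    "\<lambda>p q. (p$1 * q$2) *\<^sub>R axis 3 1" "\<lambda>p q. (- (q$1 * p$2)) *\<^sub>R axis 3 1"
    by standard
      (auto simp: axis_def vec_eq_iff case_prod_beta intro!: continuous_intros)
  have "F1.flip = r1"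
    unfolding F1.flip_def r1_def by (auto simp: fun_eq_iff vec_eq_iff forall_3 axis_def)
  then show "topological_biquandle euclidean r1"
    using F1.topological_biquandle_flip by simp
next
  interpret F2: twisted_flip "range (\<lambda>t. t *\<^sub>R axis 3 1) :: (real^3) set"
    "\<lambda>p q. (- (p$1 * q$2)) *\<^sub>R axis 3 1" "\<lambda>p q. (p$1 * q$2) *\<^sub>R axis 3 1"
    by standard
      (auto simp: axis_def vec_eq_iff case_prod_beta intro!: continuous_intros)
  have "F2.flip = r2"
    unfolding F2.flip_def r2_def by (auto simp: fun_eq_iff vec_eq_iff forall_3 axis_def)
  then show "topological_biquandle euclidean r2"
    using F2.topological_biquandle_flip by simp
qed

end
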